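(* Let $D$ be a locally convex subset of a normed space $X$ and let $f\colon D\to\mathbb{R}$ be a function. Then $$(\operatorname{lip} f)^{\vee}=(\operatorname{Lip} f)^{\vee}=\mathbb{L}\mathrm{ip} f$$ on $D$.
   Context: A subset $D$ of a normed space $X$ is called locally convex if for any point $x\in D$ and any neighborhood $U$ of $x$ in $D$ there is a convex neighborhood $V$ of $x$ in $D$ such that $V\subseteq U$. The set $D$ is regarded as a metric space with the metric $\|u-v\|$ induced by the norm, and $B(x,r)=\{u\in D:\|u-x\|<r\}$ denotes the ball in $D$. For $f\colon D\to\mathbb{R}$ and $x\in D$ (with the convention $\sup\varnothing=0$): $\mathbb{L}\mathrm{ip} f(x)=\limsup_{(u,v)\to(x,x)}\frac{|f(u)-f(v)|}{\|u-v\|}=\inf_{r>0}\sup_{u\ne v\in B(x,r)}\frac{|f(u)-f(v)|}{\|u-v\|}$ (local Lipschitz derivative); $\operatorname{Lip} f(x)=\limsup_{u\to x}\frac{|f(u)-f(x)|}{\|u-x\|}=\inf_{r>0}\sup_{u\in D,\ 0<\|u-x\|<r}\frac{|f(u)-f(x)|}{\|u-x\|}$ (big Lipschitz derivative); $\operatorname{lip} f(x)=\liminf_{r\to0^+}\sup_{u\in B(x,r)}\frac1r|f(u)-f(x)|$ (little Lipschitz derivative). All take values in $[0,+\infty]$. For a function $g\colon D\to[-\infty,+\infty]$, its upper Baire function is $g^{\vee}(x)=\inf_{U\in\mathcal{U}(x)}\sup_{u\in U}g(u)$, $x\in D$, where $\mathcal{U}(x)$ is the family of all neighborhoods of $x$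 in $D$. *)

theory Defs
  imports "HOL-Analysis.Analysis"
begin

text \<open>
  A function on \<open>D\<close> is represented by a total function; every definition below
  inspects it on \<open>D\<close> only. Extended values live in \<^typ>\<open>ereal\<close>, where the supremum of
  the empty set is \<open>-\<infinity>\<close>; \<open>sup0\<close> implements the convention that it is \<open>0\<close>.
\<close>

definition sup0 :: "ereal set \<Rightarrow> ereal" where
  "sup0 A = (if A = {} then 0 else Sup A)"

definition ball_in :: "'a::real_normed_vector set \<Rightarrow> 'a \<Rightarrow> real \<Rightarrow> 'a set" where
  "ball_in D x r = {u \<in> D. norm (u - x) < r}"

definition local_Lip :: "'a::real_normed_vector set \<Rightarrow> ('a \<Rightarrow> real) \<Rightarrow> 'a \<Rightarrow> ereal" where
  "local_Lip D f x =
     (INF r\<in>{0::real<..}.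
        sup0 {ereal (\<bar>f u - f v\<bar> / norm (u - v)) | u v.
                u \<in> ball_in D x r \<and> v \<in> ball_in D x r \<and> u \<noteq> v})"

definition big_Lip :: "'a::real_normed_vector set \<Rightarrow> ('a \<Rightarrow> real) \<Rightarrow> 'a \<Rightarrow> ereal" where
  "big_Lip D f x =
     (INF r\<in>{0::real<..}.
        sup0 {ereal (\<bar>f u - f x\<bar> / norm (u - x)) | u.
                u \<in> D \<and> 0 < norm (u - x) \<and> norm (u - x) < r})"

definition little_lip :: "'a::real_normed_vector set \<Rightarrow> ('a \<Rightarrow> real) \<Rightarrow> 'a \<Rightarrow> ereal" where
  "little_lip D f x =
     Liminf (at_right 0)
       (\<lambda>r::real. sup0 {ereal (1 / r * \<bar>f u - f x\<bar>) | u. u \<in> ball_in D x r})"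

text \<open>Neighbourhoods of \<open>x\<close> in the subspace \<open>D\<close>; they need not be open.\<close>

definition nbhds_in :: "'a::topological_space set \<Rightarrow> 'a \<Rightarrow> 'a set set" where
  "nbhds_in D x =
     {U. U \<subseteq> D \<and> (\<exists>W. openin (top_of_set D) W \<and> x \<in> W \<and> W \<subseteq> U)}"

definition upper_baire :: "'a::topological_space set \<Rightarrow> ('a \<Rightarrow> ereal) \<Rightarrow> 'a \<Rightarrow> ereal" where
  "upper_baire D g x = (INF U\<in>nbhds_in D x. SUP u\<in>U. g u)"

end

theory Submission
  imports Defs
begin

text \<open>
  The heart of the matter is that \<open>lip f < c\<close> on a convex set makes \<open>f\<close> \<open>c\<close>-Lipschitz there.
  Restricting to a segment, one gets a function \<open>g\<close> on an interval such that every point \<open>t\<close> has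
  arbitrarily small radii \<open>r\<close> for which \<open>g\<close> maps the \<open>r\<close>-ball around \<open>t\<close> into the \<open>c r\<close>-ball around
  \<open>g t\<close>. Such a \<open>g\<close> is continuous, maps null sets to null sets (cover by balls of radius \<open>r / 5\<close>,
  so that the enlarged balls in Vitali's covering lemma are again ones on which \<open>g\<close> is controlled),
  and by the Vitali covering theorem the interval between \<open>g a\<close> and \<open>g b\<close>, which is contained in
  the image of \<open>[a, b]\<close>, has length at most \<open>c (b - a)\<close>. The remaining inequalities are
  \<open>lip \<le> Lip \<le> \<L>ip\<close> and the upper semicontinuity of \<open>\<L>ip\<close>.
\<close>

section \<open>Functions on the line with small images of small balls\<close>

text \<open>On the line the length of a ball is linear in its radius and independent of its centre.
  So moving the disjoint balls to new centres and scaling radii by \<open>M\<close> multiplies the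
  total length by \<open>M\<close>; the new balls may overlap, since only subadditivity is used for
  them.\<close>

lemma emeasure_UN_cball_le:
  fixes a b r :: "'i \<Rightarrow> real"
  assumes "countable C"
    and disj: "pairwise (\<lambda>i j. disjnt (cball (a i) (r i)) (cball (a j) (r j))) C"
    and r: "\<And>i. i \<in> C \<Longrightarrow> 0 \<le> r i"
    and sub: "(\<Union>i\<in>C. cball (a i) (r i)) \<subseteq> T"
    and T: "T \<in> sets lebesgue"
    and M: "0 \<le> M"
  shows "emeasure lebesgue (\<Union>i\<in>C. cball (b i) (M * r i)) \<le> ennreal M * emeasure lebesgue T"
proof -
  \<comment> \<open>Reindexing by naturals turns the union into a series; as \<open>C\<close> may be
    finite, indices outside \<open>I\<close> get the empty set.\<close>
  define I where "I = to_nat_on C ` C"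
  define h where "h = from_nat_into C"
  have h: "h n \<in> C" if "n \<in> I" for n
    using that \<open>countable C\<close> by (auto simp: I_def h_def)
  have inj: "h m \<noteq> h n" if "m \<in> I" "n \<in> I" "m \<noteq> n" for m n
    using that \<open>countable C\<close> by (auto simp: I_def h_def)
  have hI: "h ` I = C"
    using \<open>countable C\<close> by (auto simp: I_def h_def image_iff)
  define A where "A n = (if n \<in> I then cball (a (h n)) (r (h n)) else {})" for n
  define B where "B n = (if n \<in> I then cball (b (h n)) (M * r (h n)) else {})" for n
  have AB: "emeasure lebesgue (B n) = ennreal M * emeasure lebesgue (A n)" for n
    using r[OF h, of n] M
    by (auto simp: A_def B_def cball_eq_atLeastAtMost ennreal_mult' [symmetric] algebra_simps)
  have UA: "(\<Union>n. A n) = (\<Union>i\<in>C. cball (a i) (r i))"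
    unfolding A_def hI [symmetric] by auto
  have UB: "(\<Union>n. B n) = (\<Union>i\<in>C. cball (b i) (M * r i))"
    unfolding B_def hI [symmetric] by auto
  have "disjoint_family A"
    using disj h inj unfolding disjoint_family_on_def A_def pairwise_def disjnt_def by simp
  moreover have "range A \<subseteq> sets lebesgue" by (auto simp: A_def)
  ultimately have A: "(\<Sum>n. emeasure lebesgue (A n)) = emeasure lebesgue (\<Union>n. A n)"
    by (intro suminf_emeasure)
  have "emeasure lebesgue (\<Union>n. B n) \<le> (\<Sum>n. emeasure lebesgue (B n))"
    by (intro emeasure_subadditive_countably) (auto simp: B_def)
  also have "\<dots> = ennreal M * emeasure lebesgue (\<Union>n. A n)"
    by (simp add: AB A)
  also have "\<dots> \<le> ennreal M * emeasure lebesgue T"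
    using sub T UA by (intro mult_left_mono emeasure_mono) auto
  finally show ?thesis
    by (simp add: UB)
qed

lemma negligible_image_if_small_ball_images:
  fixes g :: "real \<Rightarrow> real"
  assumes "0 \<le> c" and "negligible N" "N \<subseteq> S"
    and H: "\<And>t e. t \<in> S \<Longrightarrow> 0 < e \<Longrightarrow>
              \<exists>r. 0 < r \<and> r < e \<and> g ` (S \<inter> cball t r) \<subseteq> cball (g t) (c * r)"
  shows "negligible (g ` N)"
  unfolding negligible_outer_le
proof (intro allI impI)
  fix e :: real assume "0 < e"
  \<comment> \<open>The cover will cost a factor \<open>5 * c\<close>; the \<open>+ 1\<close> keeps
    the denominator positive when \<open>c = 0\<close>.\<close>
  define d where "d = e / (5 * c + 1)"
  have d: "0 < d" "5 * c * d \<le> e"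
    using \<open>0 < e\<close> \<open>0 \<le> c\<close> by (auto simp: d_def field_simps)
  have N: "N \<in> null_sets lebesgue"
    using \<open>negligible N\<close> by (simp add: negligible_iff_null_sets)
  then obtain T where T: "open T" "N \<subseteq> T" "emeasure lebesgue (T - N) < ennreal d"
    using sets_lebesgue_outer_open[OF _ d(1), of N] by blast
  have eT: "emeasure lebesgue T \<le> ennreal d"
    using T N emeasure_Diff_null_set[of N lebesgue T] by (simp add: borel_open sets_completionI_sets)
  \<comment> \<open>Only the ball of radius \<open>r / 5\<close> has to fit into \<open>T\<close>,
    whereas \<open>g\<close> is controlled on the whole ball of radius \<open>r\<close>. The bound 1
    supplies the bounded radii that the covering lemma requires.\<close>
  have "\<exists>r. 0 < r \<and> r \<le> 1 \<and> cball t (r / 5) \<subseteq> T \<and> g ` (S \<inter> cball t r) \<subseteq> cball (g t) (c * r)"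
    if tN: "t \<in> N" for t
  proof -
    obtain k where k: "0 < k" "cball t k \<subseteq> T"
      using T(1,2) tN by (metis open_contains_cball_eq subsetD)
    have "0 < min 1 k" using k by simp
    then obtain r where r: "0 < r" "r < min 1 k" "g ` (S \<inter> cball t r) \<subseteq> cball (g t) (c * r)"
      using H[OF subsetD[OF \<open>N \<subseteq> S\<close> tN]] by meson
    have "cball t (r / 5) \<subseteq> cball t k"
      using r by (intro subset_cball) auto
    then show ?thesis using r k by (intro exI[of _ r]) auto
  qed
  then obtain r where r: "\<And>t. t \<in> N \<Longrightarrow> 0 < r t \<and> r t \<le> 1"
    "\<And>t. t \<in> N \<Longrightarrow> cball t (r t / 5) \<subseteq> T"
    "\<And>t. t \<in> N \<Longrightarrow> g ` (S \<inter> cball t (r t)) \<subseteq> cball (g t) (c * r t)"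
    by metis
  have cov: "N \<subseteq> (\<Union>t\<in>N. cball t (r t / 5))"
    using r(1) by (force simp: less_imp_le)
  obtain C where C: "countable C" "C \<subseteq> N"
    "pairwise (\<lambda>s t. disjnt (cball s (r s / 5)) (cball t (r t / 5))) C"
    "N \<subseteq> (\<Union>t\<in>C. cball t (5 * (r t / 5)))"
    by (rule Vitali_covering_lemma_cballs[OF cov, of 1]) (use r(1) in force)+
  \<comment> \<open>The radius \<open>c * r t\<close> is written as \<open>5 * c\<close> times
    \<open>r t / 5\<close>, so that the measure estimate applies to the disjoint balls with
    \<open>M = 5 * c\<close>.\<close>
  let ?U = "\<Union>t\<in>C. cball (g t) (5 * c * (r t / 5))"
  have sub: "g ` N \<subseteq> ?U"
  proof
    fix y assume "y \<in> g ` N"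
    then obtain s where s: "s \<in> N" "y = g s" by auto
    then obtain t where "t \<in> C" "s \<in> cball t (r t)" using C(4) by auto
    then have "y \<in> cball (g t) (c * r t)"
      using r(3)[of t] s C(2) \<open>N \<subseteq> S\<close> by blast
    with \<open>t \<in> C\<close> show "y \<in> ?U" by auto
  qed
  have U: "emeasure lebesgue ?U \<le> ennreal e"
  proof -
    have "emeasure lebesgue ?U \<le> ennreal (5 * c) * emeasure lebesgue T"
      using C r \<open>0 \<le> c\<close> T(1)
      by (intro emeasure_UN_cball_le[where a = "\<lambda>t. t"])
        (auto simp: less_imp_le subset_iff borel_open sets_completionI_sets)
    also have "\<dots> \<le> ennreal (5 * c) * ennreal d"
      using eT by (rule mult_left_mono) simp
    also have "\<dots> = ennreal (5 * c * d)"
      using d \<open>0 \<le> c\<close> by (simp add: ennreal_mult')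
    also have "\<dots> \<le> ennreal e"
      using d by (intro ennreal_leI)
    finally show ?thesis .
  qed
  have meas: "?U \<in> lmeasurable"
  proof (rule fmeasurableI)
    show "?U \<in> sets lebesgue"
      using C(1) by (intro sets.countable_UN'') auto
    show "emeasure lebesgue ?U < \<infinity>"
      using U by (rule le_less_trans) simp
  qed
  have "measure lebesgue ?U \<le> e"
    unfolding measure_def using U \<open>0 < e\<close> by (intro enn2real_leI) auto
  with sub meas show "\<exists>T. g ` N \<subseteq> T \<and> T \<in> lmeasurable \<and> measure lebesgue T \<le> e"
    by (intro exI[of _ ?U] conjI)
qed

lemma abs_diff_le_if_small_ball_images:
  fixes g :: "real \<Rightarrow> real"
  assumes "0 \<le> c" and "a \<le> b"
    and H: "\<And>t e. t \<in> {a..b} \<Longrightarrow> 0 < e \<Longrightarrow>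
              \<exists>r. 0 < r \<and> r < e \<and> g ` ({a..b} \<inter> cball t r) \<subseteq> cball (g t) (c * r)"
  shows "\<bar>g b - g a\<bar> \<le> c * (b - a)"
proof -
  \<comment> \<open>A single controlled radius \<open>r\<close> with \<open>c * r < e\<close> at
    each point suffices; continuity is needed only to make the image an interval.\<close>
  have "continuous_on {a..b} g"
    unfolding continuous_on_iff
  proof (intro ballI allI impI)
    fix t e :: real assume "t \<in> {a..b}" "0 < e"
    moreover have "0 < e / (c + 1)" using \<open>0 < e\<close> \<open>0 \<le> c\<close> by simp
    ultimately obtain r where r: "0 < r" "r < e / (c + 1)"
      "g ` ({a..b} \<inter> cball t r) \<subseteq> cball (g t) (c * r)"
      using H by metis
    have "c * r < e"
      using r \<open>0 \<le> c\<close> by (simp add: field_simps)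
    then show "\<exists>d>0. \<forall>s\<in>{a..b}. dist s t < d \<longrightarrow> dist (g s) (g t) < e"
      using r by (intro exI[of _ r]) (fastforce simp: image_subset_iff dist_commute)
  qed
  then have conn: "connected (g ` {a..b})"
    by (intro connected_continuous_image) auto
  \<comment> \<open>Balls centred near the endpoints stick out of \<open>{a..b}\<close>. With radii
    below \<open>e\<close> they stay in \<open>{a - e..b + e}\<close>, which accounts for the extra
    \<open>2 * e\<close>.\<close>
  have bound: "\<bar>g b - g a\<bar> \<le> c * (b - a + 2 * e)" if "0 < e" for e
  proof -
    \<comment> \<open>Indices are pairs of centre and radius, because a Vitali cover needs
      arbitrarily small balls around the same centre.\<close>
    define K where "K = {(t, r). t \<in> {a..b} \<and> 0 < r \<and> r < e \<and>
                           g ` ({a..b} \<inter> cball t r) \<subseteq> cball (g t) (c * r)}"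
    have fine: "\<exists>i. i \<in> K \<and> t \<in> cball (fst i) (snd i) \<and> snd i < d"
      if td: "t \<in> {a..b}" "0 < d" for t d
    proof -
      have "0 < min d e" using td \<open>0 < e\<close> by simp
      then obtain r where "0 < r" "r < min d e" "g ` ({a..b} \<inter> cball t r) \<subseteq> cball (g t) (c * r)"
        using H[OF td(1)] by meson
      then show ?thesis
        using td by (intro exI[of _ "(t, r)"]) (auto simp: K_def)
    qed
    have K: "fst i \<in> {a..b}" "0 < snd i" "snd i < e"
      "g ` ({a..b} \<inter> cball (fst i) (snd i)) \<subseteq> cball (g (fst i)) (c * snd i)"
      if "i \<in> K" for i
      using that by (simp_all add: K_def case_prod_unfold)
    obtain C where C: "countable C" "C \<subseteq> K"
      "pairwise (\<lambda>i j. disjnt (cball (fst i) (snd i)) (cball (fst j) (snd j))) C"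
      "negligible ({a..b} - (\<Union>i\<in>C. cball (fst i) (snd i)))"
      by (rule Vitali_covering_theorem_cballs[of K snd "{a..b}" fst, OF K(2) fine])
    let ?U = "\<Union>i\<in>C. cball (g (fst i)) (c * snd i)"
    \<comment> \<open>The chosen balls miss only this null set; the previous lemma makes its image
      null, so it adds nothing to the length of the image.\<close>
    define N where "N = {a..b} - (\<Union>i\<in>C. cball (fst i) (snd i))"
    have N: "g ` N \<in> null_sets lebesgue"
      unfolding negligible_iff_null_sets [symmetric]
      by (rule negligible_image_if_small_ball_images[OF \<open>0 \<le> c\<close> _ _ H])
        (use C(4) in \<open>auto simp: N_def\<close>)
    have U: "?U \<in> sets lebesgue"
      using C(1) by (intro sets.countable_UN'') auto
    have "g ` {a..b} \<subseteq> ?U \<union> g ` N"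
    proof
      fix y assume "y \<in> g ` {a..b}"
      then obtain s where s: "s \<in> {a..b}" "y = g s" by auto
      show "y \<in> ?U \<union> g ` N"
      proof (cases "s \<in> N")
        case False
        then obtain i where i: "i \<in> C" "s \<in> cball (fst i) (snd i)"
          using s by (auto simp: N_def)
        then have "g ` ({a..b} \<inter> cball (fst i) (snd i)) \<subseteq> cball (g (fst i)) (c * snd i)"
          using K[of i] C(2) by blast
        then have "y \<in> cball (g (fst i)) (c * snd i)"
          using s i by blast
        with i show ?thesis by blast
      qed (use s in auto)
    qed
    moreover have "{min (g a) (g b)..max (g a) (g b)} \<subseteq> g ` {a..b}"
      using conn \<open>a \<le> b\<close> connected_contains_Icc[of "g ` {a..b}" "min (g a) (g b)" "max (g a) (g b)"]
      by (auto simp: min_def max_def)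
    ultimately have "emeasure lebesgue {min (g a) (g b)..max (g a) (g b)}
                     \<le> emeasure lebesgue (?U \<union> g ` N)"
      using U N by (intro emeasure_mono) auto
    also have "\<dots> = emeasure lebesgue ?U"
      using U N by (rule emeasure_Un_null_set)
    also have "\<dots> \<le> ennreal c * emeasure lebesgue {a - e..b + e}"
    proof (rule emeasure_UN_cball_le[where a = fst])
      show "0 \<le> snd i" if "i \<in> C" for i
        using K(2)[of i] C(2) that by auto
      have "cball (fst i) (snd i) \<subseteq> {a - e..b + e}" if "i \<in> C" for i
        using K(1,3)[of i] C(2) that by (auto simp: cball_eq_atLeastAtMost)
      then show "(\<Union>i\<in>C. cball (fst i) (snd i)) \<subseteq> {a - e..b + e}" by blast
    qed (use C \<open>0 \<le> c\<close> in auto)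
    also have "emeasure lebesgue {a - e..b + e} = ennreal (b - a + 2 * e)"
      using \<open>0 < e\<close> \<open>a \<le> b\<close> by (simp add: algebra_simps)
    also have "ennreal c * \<dots> = ennreal (c * (b - a + 2 * e))"
      using \<open>0 \<le> c\<close> by (simp add: ennreal_mult')
    finally have "ennreal \<bar>g b - g a\<bar> \<le> ennreal (c * (b - a + 2 * e))"
      by (simp add: min_def max_def split: if_splits)
    then show ?thesis
      using \<open>0 < e\<close> \<open>a \<le> b\<close> \<open>0 \<le> c\<close> by (simp add: ennreal_le_iff)
  qed
  show ?thesis
  proof (rule field_le_epsilon)
    fix e :: real assume "0 < e"
    define d where "d = e / (2 * c + 1)"
    have "0 < d" "c * (2 * d) \<le> e"
      using \<open>0 < e\<close> \<open>0 \<le> c\<close> by (auto simp: d_def field_simps)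
    then show "\<bar>g b - g a\<bar> \<le> c * (b - a) + e"
      using bound[of d] by (simp add: algebra_simps)
  qed
qed

section \<open>Lipschitz derivatives\<close>

lemma sup0_upper: "a \<in> A \<Longrightarrow> a \<le> sup0 A"
  by (auto simp: sup0_def Sup_upper)

text \<open>The premise \<open>0 \<le> c\<close> pays for the empty set, where \<open>sup0\<close>
  is 0.\<close>

lemma sup0_least: "0 \<le> c \<Longrightarrow> (\<And>a. a \<in> A \<Longrightarrow> a \<le> c) \<Longrightarrow> sup0 A \<le> c"
  by (auto simp: sup0_def Sup_least)

lemma sup0_nonneg: "(\<And>a. a \<in> A \<Longrightarrow> 0 \<le> a) \<Longrightarrow> 0 \<le> sup0 A"
  by (metis all_not_in_conv order_refl order_trans sup0_def sup0_upper)

lemma little_lip_nonneg: "0 \<le> little_lip D f x"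
  unfolding little_lip_def
  by (intro Liminf_bounded eventually_at_rightI[of 0 1] sup0_nonneg) auto

text \<open>For \<open>0 < norm (u - x) < r\<close>, replacing \<open>1 / r\<close> by
  \<open>1 / norm (u - x)\<close> only increases the quotient. Hence even the limsup over radii is
  at most each supremum in \<open>big_Lip\<close>.\<close>

lemma little_lip_le_big_Lip: "little_lip D f x \<le> big_Lip D f x"
  unfolding big_Lip_def
proof (rule INF_greatest)
  fix \<rho> :: real assume "\<rho> \<in> {0<..}"
  let ?A = "{ereal (\<bar>f u - f x\<bar> / norm (u - x)) | u. u \<in> D \<and> 0 < norm (u - x) \<and> norm (u - x) < \<rho>}"
  have nonneg: "0 \<le> sup0 ?A" by (intro sup0_nonneg) auto
  have "sup0 {ereal (1 / r * \<bar>f u - f x\<bar>) | u. u \<in> ball_in D x r} \<le> sup0 ?A"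
    if r: "0 < r" "r < \<rho>" for r
  proof (rule sup0_least[OF nonneg], clarify)
    fix u assume u: "u \<in> ball_in D x r"
    show "ereal (1 / r * \<bar>f u - f x\<bar>) \<le> sup0 ?A"
    proof (cases "u = x")
      case False
      have "1 / r * \<bar>f u - f x\<bar> \<le> \<bar>f u - f x\<bar> / norm (u - x)"
        using u r False by (simp add: ball_in_def frac_le)
      also have "ereal (\<bar>f u - f x\<bar> / norm (u - x)) \<le> sup0 ?A"
        using u r False by (intro sup0_upper) (auto simp: ball_in_def)
      finally show ?thesis by simp
    qed (use nonneg in \<open>simp add: zero_ereal_def\<close>)
  qed
  then have "Limsup (at_right 0) (\<lambda>r::real. sup0 {ereal (1 / r * \<bar>f u - f x\<bar>) | u. u \<in> ball_in D x r})
             \<le> sup0 ?A"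
    using \<open>\<rho> \<in> {0<..}\<close> by (intro Limsup_bounded eventually_at_rightI[of 0 \<rho>]) auto
  then show "little_lip D f x \<le> sup0 ?A"
    unfolding little_lip_def by (rule order_trans[OF Liminf_le_Limsup, rotated]) simp
qed

lemma upper_baire_mono:
  assumes "\<And>x. x \<in> D \<Longrightarrow> g x \<le> h x"
  shows "upper_baire D g x \<le> upper_baire D h x"
  unfolding upper_baire_def
proof (rule INF_mono)
  fix U assume U: "U \<in> nbhds_in D x"
  then have "(SUP u\<in>U. g u) \<le> (SUP u\<in>U. h u)"
    using assms by (intro SUP_subset_mono) (auto simp: nbhds_in_def)
  with U show "\<exists>U'\<in>nbhds_in D x. (SUP u\<in>U'. g u) \<le> (SUP u\<in>U. h u)" ..
qed

lemma ball_in_eq: "ball_in D x r = D \<inter> ball x r"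
  by (auto simp: ball_in_def dist_commute simp flip: dist_norm)

lemma ball_in_nbhd:
  assumes "x \<in> D" "0 < r"
  shows "ball_in D x r \<in> nbhds_in D x"
proof -
  have "openin (top_of_set D) (D \<inter> ball x r)"
    by (simp add: openin_open_Int)
  then show ?thesis
    using assms by (auto simp: nbhds_in_def ball_in_eq)
qed

text \<open>The supremum over pairs in the ball around \<open>x\<close> dominates
  \<open>big_Lip\<close> at every point of that ball, not just at \<open>x\<close>, and the ball
  itself is one of the neighbourhoods in the infimum.\<close>

lemma upper_baire_big_Lip_le_local_Lip:
  assumes "x \<in> D"
  shows "upper_baire D (big_Lip D f) x \<le> local_Lip D f x"
  unfolding local_Lip_def
proof (rule INF_greatest)
  fix r :: real assume r: "r \<in> {0<..}"
  let ?A = "{ereal (\<bar>f u - f v\<bar> / norm (u - v)) | u v.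
               u \<in> ball_in D x r \<and> v \<in> ball_in D x r \<and> u \<noteq> v}"
  have "big_Lip D f v \<le> sup0 ?A" if v: "v \<in> ball_in D x r" for v
  proof -
    \<comment> \<open>By the triangle inequality, the ball of this radius around \<open>v\<close>
      stays inside the ball of radius \<open>r\<close> around \<open>x\<close>.\<close>
    let ?k = "r - norm (v - x)"
    have "0 < ?k" using v by (simp add: ball_in_def)
    then have "big_Lip D f v \<le> sup0 {ereal (\<bar>f u - f v\<bar> / norm (u - v)) | u.
                 u \<in> D \<and> 0 < norm (u - v) \<and> norm (u - v) < ?k}"
      unfolding big_Lip_def by (intro INF_lower) simp
    also have "\<dots> \<le> sup0 ?A"
    proof (rule sup0_least)
      show "0 \<le> sup0 ?A" by (intro sup0_nonneg) auto
    next
      fix a assume "a \<in> {ereal (\<bar>f u - f v\<bar> / norm (u - v)) | u.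
                     u \<in> D \<and> 0 < norm (u - v) \<and> norm (u - v) < ?k}"
      then obtain u where u: "u \<in> D" "0 < norm (u - v)" "norm (u - v) < ?k"
        and a: "a = ereal (\<bar>f u - f v\<bar> / norm (u - v))" by blast
      have "norm (u - x) < r"
        using u norm_triangle_ineq[of "u - v" "v - x"] by simp
      then show "a \<le> sup0 ?A"
        unfolding a using u v by (intro sup0_upper) (auto simp: ball_in_def)
    qed
    finally show ?thesis .
  qed
  then have "(SUP v\<in>ball_in D x r. big_Lip D f v) \<le> sup0 ?A"
    by (rule SUP_least)
  then show "upper_baire D (big_Lip D f) x \<le> sup0 ?A"
    unfolding upper_baire_def using ball_in_nbhd[of x D r] assms r
    by (auto intro: INF_lower2)
qed

text \<open>Convexity keeps the segment from \<open>v\<close> to \<open>u\<close> inside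
  \<open>V\<close>, so the estimate on the line applies to \<open>f\<close> along it. The gap
  \<open>b < c\<close> leaves room to pass from the open balls of \<open>little_lip\<close> to the
  closed balls required there.\<close>

lemma abs_diff_le_if_little_lip_less:
  fixes V :: "'a::real_normed_vector set"
  assumes "convex V" "V \<subseteq> D" "u \<in> V" "v \<in> V"
    and lip: "\<And>x. x \<in> V \<Longrightarrow> little_lip D f x \<le> ereal b" and b: "0 \<le> b" "b < c"
  shows "\<bar>f u - f v\<bar> \<le> c * norm (u - v)"
proof (cases "u = v")
  case False
  define L where "L = norm (u - v)"
  have L: "0 < L" using False by (simp add: L_def)
  define p where "p s = v + s *\<^sub>R (u - v)" for s :: real
  \<comment> \<open>The midpoint splits the gap: \<open>b < b'\<close> yields small radii with
    quotient below \<open>b'\<close>, and \<open>b' < c\<close> allows shrinking them.\<close>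
  define b' where "b' = (b + c) / 2"
  have b': "b < b'" "b' < c" "0 < b'" using b by (auto simp: b'_def)
  have pV: "p s \<in> V" if "s \<in> {0..1}" for s
  proof -
    have "p s = (1 - s) *\<^sub>R v + s *\<^sub>R u" by (simp add: p_def algebra_simps)
    then show ?thesis using assms(1,3,4) that by (simp add: convexD_alt)
  qed
  have p_diff: "norm (p s - p t) = \<bar>s - t\<bar> * L" for s t
  proof -
    have "p s - p t = (s - t) *\<^sub>R (u - v)" by (simp add: p_def algebra_simps)
    then show ?thesis by (simp add: L_def)
  qed
  have "\<bar>(f \<circ> p) 1 - (f \<circ> p) 0\<bar> \<le> (c * L) * (1 - 0)"
  proof (rule abs_diff_le_if_small_ball_images)
    fix t e :: real assume t: "t \<in> {0..1}" and e: "0 < e"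
    let ?q = "\<lambda>r. sup0 {ereal (1 / r * \<bar>f w - f (p t)\<bar>) | w. w \<in> ball_in D (p t) r}"
    \<comment> \<open>Otherwise the liminf would be at least \<open>b'\<close>. The bound is
      \<open>e * L\<close> because \<open>p\<close> stretches distances by \<open>L\<close>.\<close>
    have "\<exists>r. 0 < r \<and> r < e * L \<and> ?q r < ereal b'"
    proof (rule ccontr)
      assume "\<nexists>r. 0 < r \<and> r < e * L \<and> ?q r < ereal b'"
      then have "ereal b' \<le> ?q r" if "r \<in> {0<..<e * L}" for r
        using that by (meson greaterThanLessThan_iff not_less)
      then have "ereal b' \<le> little_lip D f (p t)"
        unfolding little_lip_def using e L
        by (intro Liminf_bounded eventually_at_rightI[of 0 "e * L"]) auto
      also have "\<dots> \<le> ereal b" by (rule lip[OF pV[OF t]])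
      finally show False using b' by simp
    qed
    then obtain r where r: "0 < r" "r < e * L" "?q r < ereal b'" by blast
    \<comment> \<open>the closed ball of radius \<open>r b' / c < r\<close> lies in the open ball of radius \<open>r\<close>\<close>
    let ?\<rho> = "r * b' / (c * L)"
    have "r * b' < r * c" using r b' by simp
    also have "r * c < e * L * c" using r b by simp
    finally have "r * b' < e * (c * L)" by (simp add: mult_ac)
    moreover have "0 < c * L" using b L by simp
    ultimately have \<rho>: "0 < ?\<rho>" "?\<rho> < e" "?\<rho> * L < r" "c * L * ?\<rho> = b' * r"
      using r b b' L by (simp_all add: pos_divide_less_eq)
    \<comment> \<open>The bound inherited from the larger radius \<open>r\<close> is exactly
      \<open>c * L * ?\<rho>\<close>, so shrinking the ball costs nothing beyond replacing
      \<open>b'\<close> by \<open>c\<close>.\<close>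
    have "\<bar>f (p s) - f (p t)\<bar> \<le> b' * r" if s: "s \<in> {0..1}" "\<bar>s - t\<bar> \<le> ?\<rho>" for s
    proof -
      have "norm (p s - p t) \<le> ?\<rho> * L"
        unfolding p_diff using s L by (intro mult_right_mono) auto
      then have "p s \<in> ball_in D (p t) r"
        using \<rho> pV[OF s(1)] \<open>V \<subseteq> D\<close> by (auto simp: ball_in_def)
      then have "ereal (1 / r * \<bar>f (p s) - f (p t)\<bar>) \<le> ?q r"
        by (intro sup0_upper) auto
      then have "ereal (1 / r * \<bar>f (p s) - f (p t)\<bar>) < ereal b'"
        using r(3) by (rule le_less_trans)
      then show ?thesis using r by (simp add: field_simps)
    qed
    then have "(f \<circ> p) ` ({0..1} \<inter> cball t ?\<rho>) \<subseteq> cball ((f \<circ> p) t) (c * L * ?\<rho>)"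
      unfolding \<rho>(4) by (auto simp: dist_real_def abs_minus_commute)
    with \<rho> show "\<exists>r. 0 < r \<and> r < e \<and>
        (f \<circ> p) ` ({0..1} \<inter> cball t r) \<subseteq> cball ((f \<circ> p) t) (c * L * r)"
      by blast
  qed (use b L in auto)
  then show ?thesis by (simp add: p_def L_def)
qed simp

text \<open>Local convexity enters here: each neighbourhood \<open>U\<close> contains a convex
  \<open>V\<close> on which \<open>f\<close> is \<open>c\<close>-Lipschitz for every
  \<open>c\<close> above the supremum of \<open>little_lip\<close> over \<open>U\<close>.\<close>

lemma local_Lip_le_upper_baire_little_lip:
  fixes D :: "'a::real_normed_vector set"
  assumes "locally convex D" "x \<in> D"
  shows "local_Lip D f x \<le> upper_baire D (little_lip D f) x"
  unfolding upper_baire_def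
proof (rule INF_greatest)
  fix U assume "U \<in> nbhds_in D x"
  then obtain W where W: "U \<subseteq> D" "openin (top_of_set D) W" "x \<in> W" "W \<subseteq> U"
    by (auto simp: nbhds_in_def)
  then obtain G V where V: "openin (top_of_set D) G" "convex V" "x \<in> G" "G \<subseteq> V" "V \<subseteq> W"
    using assms(1) unfolding locally_def by metis
  \<comment> \<open>\<open>V\<close> need not be open, so the ball in \<open>D\<close> is taken
    inside the relatively open \<open>G\<close>.\<close>
  obtain r where r: "0 < r" "ball x r \<inter> D \<subseteq> G"
    using V(1,3) unfolding openin_contains_ball by blast
  then have ball: "ball_in D x r \<subseteq> V"
    using V(4) by (auto simp: ball_in_eq)
  let ?S = "SUP u\<in>U. little_lip D f u"
  have upper: "little_lip D f v \<le> ?S" if "v \<in> V" for v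
    using that V W by (intro SUP_upper) auto
  have nonneg: "0 \<le> ?S"
    using little_lip_nonneg upper V(3,4) by (meson order_trans subsetD)
  show "local_Lip D f x \<le> ?S"
  proof (cases ?S)
    case (real b)
    have "0 \<le> b"
      using nonneg by (simp only: real) simp
    \<comment> \<open>The Lipschitz estimate requires a constant strictly above \<open>b\<close>;
      letting \<open>c\<close> decrease to \<open>b\<close> recovers the bound.\<close>
    have "local_Lip D f x \<le> ereal c" if "b < c" for c
    proof -
      have "local_Lip D f x \<le> sup0 {ereal (\<bar>f u - f v\<bar> / norm (u - v)) | u v.
              u \<in> ball_in D x r \<and> v \<in> ball_in D x r \<and> u \<noteq> v}"
        unfolding local_Lip_def using r by (intro INF_lower) simp
      also have "\<dots> \<le> ereal c"
      proof (rule sup0_least, goal_cases)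
        case 1
        show ?case using \<open>0 \<le> b\<close> that by simp
      next
        case (2 a)
        then obtain u v where uv: "u \<in> V" "v \<in> V" "u \<noteq> v"
          and a: "a = ereal (\<bar>f u - f v\<bar> / norm (u - v))"
          using ball by blast
        have "\<bar>f u - f v\<bar> \<le> c * norm (u - v)"
          using V W uv upper \<open>0 \<le> b\<close> that unfolding real
          by (intro abs_diff_le_if_little_lip_less[of V D]) auto
        then show ?case using uv by (simp add: a divide_le_eq)
      qed
      finally show ?thesis .
    qed
    then have "local_Lip D f x \<le> ereal b + ereal e" if "0 < e" for e
      using that by simp
    then show ?thesis
      unfolding real by (rule ereal_le_epsilon2)
  next
    case MInf
    with nonneg show ?thesis by (simp only: MInf) simp
  next
    case PInf
    show ?thesis unfolding PInf by simp
  qed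
qed

theorem theorem7p1:
  fixes D :: "'a::real_normed_vector set" and f :: "'a \<Rightarrow> real"
  assumes "locally convex D"
  shows "\<forall>x\<in>D. upper_baire D (little_lip D f) x = upper_baire D (big_Lip D f) x
             \<and> upper_baire D (big_Lip D f) x = local_Lip D f x"
proof
  fix x assume x: "x \<in> D"
  have "upper_baire D (little_lip D f) x \<le> upper_baire D (big_Lip D f) x"
    by (rule upper_baire_mono[OF little_lip_le_big_Lip])
  \<comment> \<open>The three inequalities form a cycle, which forces equality throughout.\<close>
  moreover note upper_baire_big_Lip_le_local_Lip[OF x, of f]
    local_Lip_le_upper_baire_little_lip[OF assms x, of f]
  ultimately show "upper_baire D (little_lip D f) x = upper_baire D (big_Lip D f) x
             \<and> upper_baire D (big_Lip D f) x = local_Lip D f x"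
    by auto
qed

end
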